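(* Let $S=\langle L,\leq,\top,\bot,\Box,\boxtimes\rangle$ be a consistent abstract provability structure and let $\triangle v$ be a one-variable APS term of the form $$\triangle v=\Box^{k_0}\boxtimes\Box^{k_1}\boxtimes\cdots\boxtimes\Box^{k_n}v,$$ where $n\geq 1$ and $k_0,\dots,k_n$ are natural numbers. Let $k=\min\{k_0,k_1,\ldots,k_{n-1}\}$. Suppose that $\mathsf{E}_S(\boxtimes\Box^k)$ holds. Then $\triangle\top$ is not refutable in $S$.
   Context: An abstract provability structure (APS) is a tuple $S=\langle L,\leq,\top,\bot,\Box,\boxtimes\rangle$ where $L$ is a nonempty set, $\leq$ is a partial order on $L$, $\top,\bot\in L$, and $\Box,\boxtimes$ are unary operations on $L$ such that for all $x,y\in L$: (C1) if $x\leq y$ then $\Box x\leq\Box y$ and $\boxtimes y\leq\boxtimes x$; (C2) $\top\leq\boxtimes\bot$; (C3) if $x\leq\Box y$ and $x\leq\boxtimes y$ then $x\leq\boxtimes\top$; (C4) $\boxtimes x\leq\Box\boxtimes x$; (C5) $x\leq\top$. (It is not assumed that $\bot$ is the least element.) $S$ is consistent if $\top\not\leq\bot$. An element $x\in L$ is refutable in $S$ if $x\leq\bot$. A one-variable APS term $\triangle v$ is generated from the variable $v$ by finitely many applications of $\Box$ and $\boxtimes$; it induces a unary operation $x\mapsto\triangle x$ on $L$. Compositions are written by concatenation, and $\Box^n$ is the $n$-fold iterate of $\Box$. Natural numbers include $0$. $\mathsf{E}_S(\boxtimes\Box^k)$ means that there is $p\in L$ with $\boxtimes\Box^k p=p$.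 *)

theory Defs
  imports Main
begin

record 'a provability_structure =
  carrier :: "'a set"
  leq :: "'a \<Rightarrow> 'a \<Rightarrow> bool" (infix \<open>\<sqsubseteq>\<index>\<close> 50)
  truth :: 'a (\<open>\<top>\<index>\<close>)
  falsum :: 'a (\<open>\<bottom>\<index>\<close>)
  provable :: "'a \<Rightarrow> 'a" (\<open>\<box>\<index> _\<close> [80] 80)
  refutation :: "'a \<Rightarrow> 'a" (\<open>\<boxtimes>\<index> _\<close> [80] 80)

text \<open>The record fields are total on the type; all conditions concern the carrier only, and
  \<open>\<bottom>\<close> is not assumed to be the least element.\<close>

locale abstract_provability_structure =
  fixes S :: "'a provability_structure" (structure)
  assumes carrier_nonempty: "carrier S \<noteq> {}"
    and leq_refl: "reflp_on (carrier S) (\<sqsubseteq>)"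
    and leq_trans: "transp_on (carrier S) (\<sqsubseteq>)"
    and leq_antisym: "antisymp_on (carrier S) (\<sqsubseteq>)"
    and truth_closed: "\<top> \<in> carrier S"
    and falsum_closed: "\<bottom> \<in> carrier S"
    and provable_closed: "x \<in> carrier S \<Longrightarrow> \<box> x \<in> carrier S"
    and refutation_closed: "x \<in> carrier S \<Longrightarrow> \<boxtimes> x \<in> carrier S"
    and C1: "\<lbrakk>x \<in> carrier S; y \<in> carrier S; x \<sqsubseteq> y\<rbrakk> \<Longrightarrow> \<box> x \<sqsubseteq> \<box> y \<and> \<boxtimes> y \<sqsubseteq> \<boxtimes> x"
    and C2: "\<top> \<sqsubseteq> \<boxtimes> \<bottom>"
    and C3: "\<lbrakk>x \<in> carrier S; y \<in> carrier S; x \<sqsubseteq> \<box> y; x \<sqsubseteq> \<boxtimes> y\<rbrakk> \<Longrightarrow> x \<sqsubseteq> \<boxtimes> \<top>"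
    and C4: "x \<in> carrier S \<Longrightarrow> \<boxtimes> x \<sqsubseteq> \<box> (\<boxtimes> x)"
    and C5: "x \<in> carrier S \<Longrightarrow> x \<sqsubseteq> \<top>"

definition consistent :: "'a provability_structure \<Rightarrow> bool" where
  "consistent S \<longleftrightarrow> \<not> \<top>\<^bsub>S\<^esub> \<sqsubseteq>\<^bsub>S\<^esub> \<bottom>\<^bsub>S\<^esub>"

definition refutable :: "'a provability_structure \<Rightarrow> 'a \<Rightarrow> bool" where
  "refutable S x \<longleftrightarrow> x \<sqsubseteq>\<^bsub>S\<^esub> \<bottom>\<^bsub>S\<^esub>"

datatype aps_term = Var | Box aps_term | Boxtimes aps_term

primrec interp :: "'a provability_structure \<Rightarrow> aps_term \<Rightarrow> 'a \<Rightarrow> 'a" where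
  "interp S Var x = x"
| "interp S (Box t) x = \<box>\<^bsub>S\<^esub> (interp S t x)"
| "interp S (Boxtimes t) x = \<boxtimes>\<^bsub>S\<^esub> (interp S t x)"

text \<open>\<open>has_fixed_point S t\<close> is the condition written $\mathsf{E}_S(t)$.\<close>

definition has_fixed_point :: "'a provability_structure \<Rightarrow> aps_term \<Rightarrow> bool" where
  "has_fixed_point S t \<longleftrightarrow> (\<exists>p\<in>carrier S. interp S t p = p)"

text \<open>\<open>block_term k n\<close> is $\Box^{k_0}\boxtimes\Box^{k_1}\boxtimes\cdots\boxtimes\Box^{k_n}v$,
  with exactly \<open>n\<close> occurrences of $\boxtimes$.\<close>

definition block_term :: "(nat \<Rightarrow> nat) \<Rightarrow> nat \<Rightarrow> aps_term" where
  "block_term k n = foldr (\<lambda>i t. (Box ^^ k i) (Boxtimes t)) [0..<n] ((Box ^^ k n) Var)"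

end

theory Submission
  imports Defs
begin

text \<open>A fixed point \<open>p = \<boxtimes> \<box>\<^sup>k p\<close> satisfies \<open>p \<sqsubseteq> \<box> p\<close> by C4, hence \<open>p \<sqsubseteq> \<box> \<box>\<^sup>k p\<close>, and C3 yields
  \<open>p = \<boxtimes> \<top>\<close>. The term value is \<open>\<box>\<^sup>m \<boxtimes> u\<close> with \<open>m = k\<^sub>0 \<ge> k\<close>, so it lies above \<open>\<box>\<^sup>m p\<close>. Were it
  refutable, then \<open>p \<sqsubseteq> \<box>\<^sup>m p \<sqsubseteq> \<bottom>\<close>, and \<open>\<top> \<sqsubseteq> \<boxtimes> \<bottom> \<sqsubseteq> \<boxtimes> \<box>\<^sup>m p \<sqsubseteq> \<boxtimes> \<box>\<^sup>k p = p \<sqsubseteq> \<bottom>\<close>, contradicting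
  consistency. Only the first exponent matters.\<close>

lemma interp_Box_funpow:
  "interp S ((Box ^^ m) t) x = (provable S ^^ m) (interp S t x)"
  by (induction m) simp_all

lemma block_term_pos:
  assumes "n \<ge> 1"
  obtains t where "block_term k n = (Box ^^ k 0) (Boxtimes t)"
  using assms by (auto simp: block_term_def upt_conv_Cons)

context abstract_provability_structure
begin

lemma trans:
  assumes "x \<sqsubseteq> y" "y \<sqsubseteq> z" "x \<in> carrier S" "y \<in> carrier S" "z \<in> carrier S"
  shows "x \<sqsubseteq> z"
  using leq_trans assms by (auto dest: transp_onD)

lemma provable_funpow_closed:
  "x \<in> carrier S \<Longrightarrow> (provable S ^^ m) x \<in> carrier S"
  by (induction m) (simp_all add: provable_closed)

lemma provable_funpow_mono:
  assumes "x \<in> carrier S" "y \<in> carrier S" "x \<sqsubseteq> y"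
  shows "(provable S ^^ m) x \<sqsubseteq> (provable S ^^ m) y"
  using assms by (induction m) (simp_all add: C1 provable_funpow_closed)

text \<open>Monotonicity carries \<open>x \<sqsubseteq> \<box> x\<close> through every power of
  \<open>\<box>\<close>, so the iterates of \<open>x\<close> form an ascending chain.\<close>

lemma provable_funpow_le:
  assumes x: "x \<in> carrier S" "x \<sqsubseteq> \<box> x" and "i \<le> j"
  shows "(provable S ^^ i) x \<sqsubseteq> (provable S ^^ j) x"
  using \<open>i \<le> j\<close>
proof (induction j rule: dec_induct)
  case base
  show ?case
    using leq_refl x(1) by (auto dest: reflp_onD intro: provable_funpow_closed)
next
  case (step j)
  have "(provable S ^^ j) x \<sqsubseteq> (provable S ^^ Suc j) x"
    \<comment> \<open>Monotonicity puts the extra box innermost; \<open>funpow_swap1\<close>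
      reconciles this with \<open>Suc j\<close>.\<close>
    using provable_funpow_mono[OF x(1) provable_closed x(2)] x(1)
    by (simp add: funpow_swap1)
  with step.IH show ?case
    by (rule trans) (use x(1) in \<open>auto intro: provable_funpow_closed provable_closed\<close>)
qed

lemma interp_closed:
  "x \<in> carrier S \<Longrightarrow> interp S t x \<in> carrier S"
  by (induction t) (simp_all add: provable_closed refutation_closed)

lemma fixed_point_eq_refutation_truth:
  assumes p: "p \<in> carrier S" and fp: "\<boxtimes> ((provable S ^^ k) p) = p"
  shows "p = \<boxtimes> \<top>"
proof -
  have q: "(provable S ^^ k) p \<in> carrier S"
    using p by (rule provable_funpow_closed)
  have "p \<sqsubseteq> \<box> p"
    using C4[OF q] fp by simp
  \<comment> \<open>Climbing from exponent 0 to \<open>Suc k\<close> gives the first premise of C3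
    with \<open>y\<close> the \<open>k\<close>-th iterate of \<open>p\<close>.\<close>
  then have "p \<sqsubseteq> \<box> ((provable S ^^ k) p)"
    using provable_funpow_le[OF p, of 0 "Suc k"] by simp
  moreover have "p \<sqsubseteq> \<boxtimes> ((provable S ^^ k) p)"
    using leq_refl p fp by (simp add: reflp_onD)
  ultimately have "p \<sqsubseteq> \<boxtimes> \<top>"
    using C3 p q by blast
  moreover have "\<boxtimes> \<top> \<sqsubseteq> p"
    using C1[OF q truth_closed C5[OF q]] fp by simp
  ultimately show ?thesis
    using leq_antisym p refutation_closed[OF truth_closed] by (auto dest: antisymp_onD)
qed

lemma provable_funpow_refutation_not_refutable:
  assumes "consistent S" and u: "u \<in> carrier S" and "k \<le> m"
    and p: "p \<in> carrier S" and fp: "\<boxtimes> ((provable S ^^ k) p) = p"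
  shows "\<not> refutable S ((provable S ^^ m) (\<boxtimes> u))"
proof
  assume "refutable S ((provable S ^^ m) (\<boxtimes> u))"
  then have ref: "(provable S ^^ m) (\<boxtimes> u) \<sqsubseteq> \<bottom>"
    by (simp add: refutable_def)
  note closed = p u provable_funpow_closed refutation_closed truth_closed falsum_closed
  \<comment> \<open>Being \<open>\<boxtimes> \<top>\<close>, \<open>p\<close> lies below every
    refutation, since \<open>\<boxtimes>\<close> is antitone.\<close>
  have "p \<sqsubseteq> \<boxtimes> u"
    using C1[OF u truth_closed C5[OF u]] fixed_point_eq_refutation_truth[OF p fp] by simp
  then have "(provable S ^^ m) p \<sqsubseteq> (provable S ^^ m) (\<boxtimes> u)"
    by (intro provable_funpow_mono closed)
  then have below: "(provable S ^^ m) p \<sqsubseteq> \<bottom>"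
    using ref by (rule trans) (intro closed)+
  have incr: "p \<sqsubseteq> \<box> p"
    using C4[of "(provable S ^^ k) p"] fp provable_funpow_closed[OF p] by simp
  have "p \<sqsubseteq> (provable S ^^ m) p"
    using provable_funpow_le[OF p incr, of 0 m] by simp
  then have "p \<sqsubseteq> \<bottom>"
    using below by (rule trans) (intro closed)+
  \<comment> \<open>Here \<open>k \<le> m\<close> enters: the bound by \<open>\<bottom>\<close> must
    reach the \<open>k\<close>-th iterate, whose refutation is \<open>p\<close>.\<close>
  have "(provable S ^^ k) p \<sqsubseteq> (provable S ^^ m) p"
    using provable_funpow_le[OF p incr \<open>k \<le> m\<close>] .
  then have "(provable S ^^ k) p \<sqsubseteq> \<bottom>"
    using below by (rule trans) (intro closed)+
  then have "\<boxtimes> \<bottom> \<sqsubseteq> p"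
    using C1[of "(provable S ^^ k) p" \<bottom>] fp provable_funpow_closed[OF p] falsum_closed by simp
  with C2 have "\<top> \<sqsubseteq> p"
    by (rule trans) (intro closed)+
  then have "\<top> \<sqsubseteq> \<bottom>"
    using \<open>p \<sqsubseteq> \<bottom>\<close> by (rule trans) (intro closed)+
  with \<open>consistent S\<close> show False
    by (simp add: consistent_def)
qed

end

theorem proposition6p2:
  fixes S :: "'a provability_structure"
    and t :: aps_term
    and ks :: "nat \<Rightarrow> nat"
    and n k :: nat
  assumes "abstract_provability_structure S"
    and "consistent S"
    and "n \<ge> 1"
    and "t = block_term ks n"
    and "k = Min (ks ` {..<n})"
    and "has_fixed_point S (Boxtimes ((Box ^^ k) Var))"
  shows "\<not> refutable S (interp S t \<top>\<^bsub>S\<^esub>)"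
proof -
  interpret abstract_provability_structure S by fact
  obtain p where p: "p \<in> carrier S" "\<boxtimes>\<^bsub>S\<^esub> ((provable S ^^ k) p) = p"
    using assms(6) by (auto simp: has_fixed_point_def interp_Box_funpow)
  obtain t' where t': "t = (Box ^^ ks 0) (Boxtimes t')"
    using block_term_pos assms(3,4) by metis
  \<comment> \<open>As \<open>n \<ge> 1\<close>, the index 0 lies in \<open>{..<n}\<close>, so
    \<open>ks 0\<close> is among the values minimised.\<close>
  have "k \<le> ks 0"
    using assms(3,5) by simp
  with \<open>consistent S\<close> interp_closed[OF truth_closed]
  show ?thesis
    unfolding t' interp_Box_funpow interp.simps
    using p by (intro provable_funpow_refutation_not_refutable)
qed

end
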